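(* Let $\mathbb F$ be an algebraically closed field and $V$ a vector space over $\mathbb F$ of dimension $d+1$ with $d\ge3$. Let $\Phi=(A;\{E_i\}_{i=0}^d;A^*;\{E^*_i\}_{i=0}^d)$ be a Leonard system on $V$, with dual eigenvalue sequence $\{\theta^*_i\}_{i=0}^d$, and let $a_i=\mathrm{tr}(E^*_iA)$ for $0\le i\le d$. For $0\le i\le d$ put $$a^-_i=(a_i-a_0)(\theta^*_i-\theta^*_d),\qquad a^+_i=(a_i-a_d)(\theta^*_i-\theta^*_0),$$ and let $L$ be the $4\times(d+1)$ matrix whose rows are $(1,1,\ldots,1)$, $(\theta^*_0,\theta^*_1,\ldots,\theta^*_d)$, $(a^-_0,a^-_1,\ldots,a^-_d)$, $(a^+_0,a^+_1,\ldots,a^+_d)$. Then the following are equivalent: (i) ${\mathcal Z}(\Phi)\neq0$; (ii) $\mathrm{rank}(L)\le3$; (iii) the vectors $(a^-_0,a^-_1,\ldots,a^-_d)$ and $(a^+_0,a^+_1,\ldots,a^+_d)$ are linearly dependent; (iv) $a^-_ia^+_j=a^+_ia^-_j$ for $0\le i,j\le d$; (v) the vectors $(a^-_1,a^-_2,\ldots,a^-_{d-1})$ and $(a^+_1,a^+_2,\ldots,a^+_{d-1})$ are linearly dependent; (vi) $a^-_ia^+_j=a^+_ia^-_j$ for $1\le i,j\le d-1$.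
   Context: A tridiagonal matrix is irreducible if all entries on its subdiagonal and superdiagonal are nonzero. A Leonard pair on $V$ is an ordered pair $A,A^*\in \mathrm{End}(V)$ such that (i) there is a basis of $V$ with respect to which $A$ is irreducible tridiagonal and $A^*$ is diagonal; (ii) there is a basis of $V$ with respect to which $A^*$ is irreducible tridiagonal and $A$ is diagonal. Then $A,A^*$ are multiplicity-free (diagonalizable with one-dimensional eigenspaces). The primitive idempotent of $A$ for an eigenvalue $\theta$ is the projection onto the $\theta$-eigenspace along the sum of the other eigenspaces. An ordering of the eigenvalues of $A$ (and the corresponding ordering $\{E_i\}_{i=0}^d$ of primitive idempotents) is standard if corresponding eigenvectors $v_0,\dots,v_d$, in this order, form a basis as in (ii). Standard orderings for $A^*$ are defined similarly using (i). A Leonard system on $V$ is a sequence $\Phi=(A;\{E_i\}_{i=0}^d;A^*;\{E^*_i\}_{i=0}^d)$ where $A,A^*$ is a Leonard pair on $V$ and $\{E_i\}$, $\{E^*_i\}$ are standard orderings of the primitive idempotents of $A$, $A^*$. The dual eigenvalue sequence $\{\theta^*_i\}$ is given by $A^*E^*_i=\theta^*_iE^*_i$. Zero diagonal space: ${\mathcal Z}(\Phi)$ is the set of $X\in\mathrm{Span}\{I,A^*,A,AA^*\}$ such that $E^*_iXE^*_i=0$ for $0\le i\le d$. Known fact: $I,A^*,A,AA^*,A^*A$ are linearly independent. Two vectors $u,v$ are linearly dependent if $\lambda u+\mu v=0$ for some scalars $\lambda,\mu$ not both zero. *)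

theory Defs
  imports
    "HOL-Library.Function_Algebras"
    "HOL-Computational_Algebra.Polynomial"
    "Jordan_Normal_Form.DL_Rank"
begin

definition irreducible_tridiagonal_mat :: "'a::zero mat \<Rightarrow> bool" where
  "irreducible_tridiagonal_mat B \<longleftrightarrow>
     (\<forall>i<dim_row B. \<forall>j<dim_col B.
        (i + 1 < j \<or> j + 1 < i \<longrightarrow> B $$ (i, j) = 0) \<and>
        (j = i + 1 \<or> i = j + 1 \<longrightarrow> B $$ (i, j) \<noteq> 0))"

definition linearly_dependent_pair :: "'a::field vec \<Rightarrow> 'a vec \<Rightarrow> bool" where
  "linearly_dependent_pair u v \<longleftrightarrow>
     (\<exists>l m. (l \<noteq> 0 \<or> m \<noteq> 0) \<and> l \<cdot>\<^sub>v u + m \<cdot>\<^sub>v v = 0\<^sub>v (dim_vec u))"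

text \<open>
  The vector space \<open>V\<close> is the whole type \<open>'b\<close>, with scalar multiplication \<open>(*s)\<close>; elements of
  \<open>End(V)\<close> are functions satisfying \<open>Vector_Spaces.linear (*s) (*s)\<close>. The notions below take
  \<open>(*s)\<close> as an explicit argument and have their intended meaning when \<open>vector_space (*s)\<close> holds.
\<close>

context
  fixes scale :: "'a::field \<Rightarrow> 'b::ab_group_add \<Rightarrow> 'b" (infixr \<open>*s\<close> 75)
begin

definition ordered_basis :: "'b list \<Rightarrow> bool" where
  "ordered_basis vs \<longleftrightarrow> distinct vs \<and> \<not> Modules.module.dependent (*s) (set vs) \<and>
     Modules.module.span (*s) (set vs) = UNIV"

text \<open>Column \<open>j\<close> holds the coordinates of \<open>f (vs ! j)\<close> in the basis \<open>vs\<close>.\<close>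

definition matrix_wrt :: "'b list \<Rightarrow> ('b \<Rightarrow> 'b) \<Rightarrow> 'a mat" where
  "matrix_wrt vs f =
     mat (length vs) (length vs)
       (\<lambda>(i, j). Modules.module.representation (*s) (set vs) (f (vs ! j)) (vs ! i))"

text \<open>
  The trace does not depend on the chosen basis; the definition is meaningful only for linear
  \<open>f\<close> on a finite-dimensional space.
\<close>

definition end_trace :: "('b \<Rightarrow> 'b) \<Rightarrow> 'a" where
  "end_trace f =
     (let M = matrix_wrt (SOME vs. ordered_basis vs) f in \<Sum>i<dim_row M. M $$ (i, i))"

definition eigenspace :: "('b \<Rightarrow> 'b) \<Rightarrow> 'a \<Rightarrow> 'b set" where
  "eigenspace f \<theta> = {v. f v = \<theta> *s v}"

definition eigenvalues :: "('b \<Rightarrow> 'b) \<Rightarrow> 'a set" where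
  "eigenvalues f = {\<theta>. \<exists>v. v \<noteq> 0 \<and> f v = \<theta> *s v}"

definition projection_along :: "('b \<Rightarrow> 'b) \<Rightarrow> 'b set \<Rightarrow> 'b set \<Rightarrow> bool" where
  "projection_along P W U \<longleftrightarrow>
     Vector_Spaces.linear (*s) (*s) P \<and> P \<circ> P = P \<and> range P = W \<and> {v. P v = 0} = U"

definition primitive_idempotent :: "('b \<Rightarrow> 'b) \<Rightarrow> 'a \<Rightarrow> ('b \<Rightarrow> 'b) \<Rightarrow> bool" where
  "primitive_idempotent f \<theta> P \<longleftrightarrow>
     projection_along P (eigenspace f \<theta>)
       (Modules.module.span (*s) (\<Union>\<mu>\<in>eigenvalues f - {\<theta>}. eigenspace f \<mu>))"

definition leonard_basis :: "('b \<Rightarrow> 'b) \<Rightarrow> ('b \<Rightarrow> 'b) \<Rightarrow> 'b list \<Rightarrow> bool" where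
  "leonard_basis T D vs \<longleftrightarrow>
     ordered_basis vs \<and> irreducible_tridiagonal_mat (matrix_wrt vs T) \<and>
     diagonal_mat (matrix_wrt vs D)"

definition leonard_pair :: "('b \<Rightarrow> 'b) \<Rightarrow> ('b \<Rightarrow> 'b) \<Rightarrow> bool" where
  "leonard_pair A As \<longleftrightarrow>
     Vector_Spaces.linear (*s) (*s) A \<and> Vector_Spaces.linear (*s) (*s) As \<and>
     (\<exists>vs. leonard_basis A As vs) \<and> (\<exists>vs. leonard_basis As A vs)"

text \<open>
  \<open>standard_ordering d T D \<theta>\<close>: the sequence \<open>\<theta> 0, ..., \<theta> d\<close> is a standard ordering of the
  eigenvalues of \<open>D\<close>, where \<open>T\<close> is the other member of the Leonard pair. Corresponding
  eigenvectors are unique up to nonzero scalars, so it is immaterial which ones are taken.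
\<close>

definition standard_ordering ::
    "nat \<Rightarrow> ('b \<Rightarrow> 'b) \<Rightarrow> ('b \<Rightarrow> 'b) \<Rightarrow> (nat \<Rightarrow> 'a) \<Rightarrow> bool" where
  "standard_ordering d T D \<theta> \<longleftrightarrow>
     bij_betw \<theta> {..d} (eigenvalues D) \<and>
     (\<exists>vs. length vs = d + 1 \<and> (\<forall>i\<le>d. D (vs ! i) = \<theta> i *s (vs ! i)) \<and> leonard_basis T D vs)"

text \<open>\<open>As\<close> and \<open>Es\<close> stand for the starred \<open>A\<close> and \<open>E\<close>; only \<open>E i\<close> and \<open>Es i\<close> with \<open>i \<le> d\<close> matter.\<close>

definition leonard_system ::
    "nat \<Rightarrow> ('b \<Rightarrow> 'b) \<Rightarrow> (nat \<Rightarrow> 'b \<Rightarrow> 'b) \<Rightarrow> ('b \<Rightarrow> 'b) \<Rightarrow> (nat \<Rightarrow> 'b \<Rightarrow> 'b) \<Rightarrow> bool" where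
  "leonard_system d A E As Es \<longleftrightarrow>
     leonard_pair A As \<and>
     (\<exists>\<theta>. standard_ordering d As A \<theta> \<and> (\<forall>i\<le>d. primitive_idempotent A (\<theta> i) (E i))) \<and>
     (\<exists>\<theta>. standard_ordering d A As \<theta> \<and> (\<forall>i\<le>d. primitive_idempotent As (\<theta> i) (Es i)))"

definition dual_eigenvalue_sequence ::
    "nat \<Rightarrow> ('b \<Rightarrow> 'b) \<Rightarrow> (nat \<Rightarrow> 'b \<Rightarrow> 'b) \<Rightarrow> (nat \<Rightarrow> 'a) \<Rightarrow> bool" where
  "dual_eigenvalue_sequence d As Es \<theta>s \<longleftrightarrow> (\<forall>i\<le>d. As \<circ> Es i = (\<lambda>v. \<theta>s i *s Es i v))"

text \<open>The span is taken in the space of functions on \<open>V\<close> with pointwise operations.\<close>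

definition zero_diagonal_space ::
    "nat \<Rightarrow> ('b \<Rightarrow> 'b) \<Rightarrow> ('b \<Rightarrow> 'b) \<Rightarrow> (nat \<Rightarrow> 'b \<Rightarrow> 'b) \<Rightarrow> ('b \<Rightarrow> 'b) set" where
  "zero_diagonal_space d A As Es =
     {X \<in> Modules.module.span (\<lambda>c f v. c *s f v) {id, As, A, A \<circ> As}.
        \<forall>i\<le>d. Es i \<circ> X \<circ> Es i = (\<lambda>_. 0)}"

end

end

(* In a standard eigenbasis of As the idempotent Es i is the i-th coordinate projection, so
   a i is the i-th diagonal entry of A, and x I + y As + z A + w A As has i-th diagonal entry
   x + y \<theta>s i + z a i + w a i \<theta>s i.  As \<theta>s 0 and \<theta>s d differ, the sequences 1, \<theta>s, a, a \<theta>s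
   and 1, \<theta>s, am, ap are related by an invertible change of coefficients; both a nonzero
   element of the zero diagonal space and a rank defect of L thus amount to a relation among
   1, \<theta>s, am, ap.  Since am and ap vanish at 0 and d, evaluating there removes
   1 and \<theta>s from the relation. *)

theory Submission
  imports Defs
begin

section \<open>Row rank defects and left null vectors\<close>

text \<open>The rank is the size of a maximal independent set \<open>S\<close> of columns. If
  \<open>S\<close> has fewer than \<open>n\<close> elements, a square matrix with the elements of
  \<open>S\<close> as rows has room for a zero row, hence a nonzero kernel vector; it is orthogonal
  to \<open>span S\<close>, which contains every column. If \<open>S\<close> has \<open>n\<close>
  elements it is a basis, and only the zero vector is orthogonal to it.\<close>

lemma (in vec_space) rank_less_iff_left_null_vector:
  assumes A: "A \<in> carrier_mat n nc"
  shows "rank A < n \<longleftrightarrow> (\<exists>y\<in>carrier_vec n. y \<noteq> 0\<^sub>v n \<and> (\<forall>c\<in>set (cols A). y \<bullet> c = 0))"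
proof -
  have cols: "set (cols A) \<subseteq> carrier_vec n"
    using A cols_dim by blast
  obtain S where S: "finite S" "maximal S (\<lambda>T. T \<subseteq> set (cols A) \<and> lin_indpt T)"
    using maximal_exists_superset[of "set (cols A)" "\<lambda>T. T \<subseteq> set (cols A) \<and> lin_indpt T" "{}"]
    by (auto simp: finite_lin_indpt2)
  have rank: "rank A = card S"
    by (rule rank_card_indpt[OF A S(2)])
  have Scols: "S \<subseteq> set (cols A)" and Sli: "lin_indpt S"
    using S(2) by (auto simp: maximal_def)
  have Scarrier: "S \<subseteq> carrier_vec n"
    using Scols cols by blast
  show ?thesis
  proof
    assume less: "rank A < n"
    obtain us where us: "set us = S" "distinct us"
      using finite_distinct_list[OF S(1)] by blast
    have len: "length us < n"
      using less us rank distinct_card by fastforce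
    have us_carrier: "us ! i \<in> carrier_vec n" if "i < length us" for i
      using that us Scarrier nth_mem by blast
    define c where "c i = (if i < length us then us ! i else 0\<^sub>v n)" for i
    have c: "c \<in> {0..<n} \<rightarrow> carrier_vec n"
      using us_carrier by (auto simp: c_def)
    \<comment> \<open>Since \<open>c\<close> is zero beyond \<open>us\<close>, all rows of
      \<open>M\<close> from index \<open>length us\<close> on are zero; the explicit case at
      \<open>length us\<close> only matches the shape of \<open>det_row_0\<close>.\<close>
    define M where "M = mat\<^sub>r n n (\<lambda>i. if i = length us then 0\<^sub>v n else c i)"
    have M: "M \<in> carrier_mat n n" by (simp add: M_def)
    have rowM: "row M i = us ! i" if "i < length us" for i
      unfolding M_def using that us_carrier len by (subst row_mat_of_row_fun) (auto simp: c_def)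
    have "det M = 0"
      unfolding M_def by (rule det_row_0[OF len c])
    then obtain y where y: "y \<in> carrier_vec n" "y \<noteq> 0\<^sub>v n" "M *\<^sub>v y = 0\<^sub>v n"
      using det_0_iff_vec_prod_zero_field[OF M] by blast
    have "y \<bullet> u = 0" if u: "u \<in> S" for u
    proof -
      obtain i where i: "i < length us" "u = us ! i"
        using u us(1) by (metis in_set_conv_nth)
      have "(M *\<^sub>v y) $ i = row M i \<bullet> y"
        using i len M by auto
      then have "u \<bullet> y = 0"
        using i len y(3) rowM by auto
      then show ?thesis
        using comm_scalar_prod[OF y(1)] u Scarrier by auto
    qed
    then have "y \<in> orthogonal_complement S"
      using y(1) by (auto simp: orthogonal_complement_def)
    then have y_span: "y \<in> orthogonal_complement (span S)"
      using Scarrier by simp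
    \<comment> \<open>A column outside the span could be adjoined to \<open>S\<close> without losing
      independence, against maximality.\<close>
    have "set (cols A) \<subseteq> span S"
    proof
      fix v assume v: "v \<in> set (cols A)"
      show "v \<in> span S"
      proof (rule ccontr)
        assume v_span: "v \<notin> span S"
        then have "v \<notin> S"
          using span_mem[of S] Scarrier by auto
        then have "lin_indpt (S \<union> {v})"
          using lin_dep_iff_in_span[OF _ Sli] Scarrier cols v v_span by auto
        then have "S \<union> {v} = S"
          using S(2) Scols v unfolding maximal_def by blast
        with \<open>v \<notin> S\<close> show False by blast
      qed
    qed
    then show "\<exists>y\<in>carrier_vec n. y \<noteq> 0\<^sub>v n \<and> (\<forall>c\<in>set (cols A). y \<bullet> c = 0)"
      using y(1,2) y_span by (auto simp: orthogonal_complement_def)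
  next
    assume "\<exists>y\<in>carrier_vec n. y \<noteq> 0\<^sub>v n \<and> (\<forall>c\<in>set (cols A). y \<bullet> c = 0)"
    then obtain y where y: "y \<in> carrier_vec n" "y \<noteq> 0\<^sub>v n" "\<And>c. c \<in> set (cols A) \<Longrightarrow> y \<bullet> c = 0"
      by blast
    have "card S \<le> n"
      using li_le_dim(2)[OF fin_dim _ Sli] Scarrier dim_is_n by auto
    moreover have "card S \<noteq> n"
    proof
      assume "card S = n"
      then have "basis S"
        using dim_li_is_basis[OF fin_dim S(1) _ Sli] Scarrier dim_is_n by auto
      then have "span S = carrier_vec n"
        by (simp add: basis_def)
      moreover have "y \<in> orthogonal_complement S"
        using y Scols by (auto simp: orthogonal_complement_def)
      ultimately have "y \<in> orthogonal_complement (carrier_vec n)"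
        using in_orthogonal_complement_span[OF Scarrier] by simp
      then have "y \<bullet> unit_vec n i = 0" for i
        by (auto simp: orthogonal_complement_def)
      then have "y = 0\<^sub>v n"
        using y(1) by (intro eq_vecI) (metis carrier_vecD index_zero_vec scalar_prod_right_unit, simp)
      with y(2) show False by simp
    qed
    ultimately show "rank A < n"
      using rank by simp
  qed
qed

section \<open>Linear dependence of two vectors and their 2 by 2 minors\<close>

lemma linearly_dependent_pair_vec_iff:
  "linearly_dependent_pair (vec n f) (vec n g) \<longleftrightarrow>
     (\<exists>l m. (l \<noteq> 0 \<or> m \<noteq> 0) \<and> (\<forall>i<n. l * f i + m * g i = 0))"
  unfolding linearly_dependent_pair_def by (auto simp: vec_eq_iff)

lemma linearly_dependent_pair_vec_iff_minors:
  "linearly_dependent_pair (vec n f) (vec n g) \<longleftrightarrow> (\<forall>i<n. \<forall>j<n. f i * g j = g i * f j)"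
proof
  assume "linearly_dependent_pair (vec n f) (vec n g)"
  then obtain l m where lm: "l \<noteq> 0 \<or> m \<noteq> 0" "\<And>i. i < n \<Longrightarrow> l * f i + m * g i = 0"
    by (auto simp: linearly_dependent_pair_vec_iff)
  show "\<forall>i<n. \<forall>j<n. f i * g j = g i * f j"
  proof (intro allI impI)
    fix i j assume "i < n" "j < n"
    then have e: "l * f i + m * g i = 0" "l * f j + m * g j = 0"
      by (auto simp: lm)
    \<comment> \<open>Eliminating one coefficient from the relations at \<open>i\<close> and
      \<open>j\<close> shows that both \<open>l\<close> and \<open>m\<close> annihilate the minor,
      and one of them is nonzero.\<close>
    have "l * (f i * g j - g i * f j) = (l * f i + m * g i) * g j - g i * (l * f j + m * g j)"
      by (simp add: algebra_simps)
    moreover have "m * (f i * g j - g i * f j) = f i * (l * f j + m * g j) - f j * (l * f i + m * g i)"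
      by (simp add: algebra_simps)
    ultimately show "f i * g j = g i * f j"
      using lm(1) e by auto
  qed
next
  assume *: "\<forall>i<n. \<forall>j<n. f i * g j = g i * f j"
  show "linearly_dependent_pair (vec n f) (vec n g)"
  proof (cases "\<exists>k<n. f k \<noteq> 0 \<or> g k \<noteq> 0")
    case True
    then obtain k where k: "k < n" "f k \<noteq> 0 \<or> g k \<noteq> 0" by blast
    then show ?thesis
      unfolding linearly_dependent_pair_vec_iff using *
      \<comment> \<open>With these coefficients the relation at index \<open>i\<close> is exactly
        the minor for \<open>i\<close> and \<open>k\<close>.\<close>
      by (intro exI[of _ "g k"] exI[of _ "- f k"]) (auto simp: algebra_simps)
  next
    case False
    then show ?thesis
      unfolding linearly_dependent_pair_vec_iff by (intro exI[of _ 1] exI[of _ 0]) auto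
  qed
qed

section \<open>Coordinates, traces and primitive idempotents in an ordered basis\<close>

text \<open>Indexing by position makes \<open>coord scale vs i (f (vs ! j))\<close> the entry
  \<open>(i, j)\<close> of \<open>matrix_wrt scale vs f\<close>.\<close>

definition coord :: "('a::field \<Rightarrow> 'b::ab_group_add \<Rightarrow> 'b) \<Rightarrow> 'b list \<Rightarrow> nat \<Rightarrow> 'b \<Rightarrow> 'a" where
  "coord scale vs i v = Modules.module.representation scale (set vs) v (vs ! i)"

context vector_space
begin

lemma linear_coord:
  "ordered_basis scale vs \<Longrightarrow> Vector_Spaces.linear scale (*) (coord scale vs i)"
  unfolding coord_def by (intro linear_representation) (auto simp: ordered_basis_def)

lemma coord_simps:
  assumes "ordered_basis scale vs"
  shows "coord scale vs i (u + v) = coord scale vs i u + coord scale vs i v"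
    and "coord scale vs i (scale c v) = c * coord scale vs i v"
    and "coord scale vs i 0 = 0"
  using assms
  by (auto simp: coord_def ordered_basis_def representation_add representation_scale representation_zero)

lemma coord_nth:
  assumes "ordered_basis scale vs" "i < length vs" "j < length vs"
  shows "coord scale vs i (vs ! j) = (if i = j then 1 else 0)"
  using assms by (auto simp: coord_def ordered_basis_def representation_basis nth_eq_iff_index_eq)

lemma sum_coord:
  assumes "ordered_basis scale vs"
  shows "(\<Sum>i<length vs. scale (coord scale vs i v) (vs ! i)) = v"
proof -
  have "bij_betw ((!) vs) {..<length vs} (set vs)"
    using assms by (intro bij_betw_nth) (auto simp: ordered_basis_def)
  then have "(\<Sum>i<length vs. scale (coord scale vs i v) (vs ! i)) = 
      (\<Sum>b\<in>set vs. scale (representation (set vs) v b) b)"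
    unfolding coord_def by (rule sum.reindex_bij_betw)
  also have "\<dots> = v"
    using assms by (intro sum_representation_eq) (auto simp: ordered_basis_def)
  finally show ?thesis .
qed

lemma linear_eq_coord_scale:
  assumes "ordered_basis scale vs" "Vector_Spaces.linear scale scale P" "i < length vs"
    and P: "\<And>j. j < length vs \<Longrightarrow> P (vs ! j) = (if j = i then vs ! i else 0)"
  shows "P v = scale (coord scale vs i v) (vs ! i)"
proof -
  interpret P: Vector_Spaces.linear scale scale P by fact
  have "P v = P (\<Sum>j<length vs. scale (coord scale vs j v) (vs ! j))"
    by (simp add: sum_coord[OF assms(1)])
  also have "\<dots> = (\<Sum>j<length vs. scale (coord scale vs j v) (if j = i then vs ! i else 0))"
    by (simp add: P.sum P.scale P)
  also have "\<dots> = (\<Sum>j<length vs. if j = i then scale (coord scale vs j v) (vs ! i) else 0)"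
    by (intro sum.cong) auto
  also have "\<dots> = scale (coord scale vs i v) (vs ! i)"
    using assms(3) by simp
  finally show ?thesis .
qed

text \<open>In any basis the diagonal sum collapses, by linearity of \<open>\<phi>\<close>, to
  \<open>\<phi>\<close> applied to the expansion of \<open>w\<close>. The value is thus the same for
  whichever basis \<open>SOME\<close> picks; \<open>ws\<close> guarantees that there is one to
  pick.\<close>

lemma end_trace_rank_one:
  assumes "ordered_basis scale ws" and phi: "Vector_Spaces.linear scale (*) \<phi>"
  shows "end_trace scale (\<lambda>v. scale (\<phi> v) w) = \<phi> w"
proof -
  interpret phi: Vector_Spaces.linear scale "(*)" \<phi> by fact
  define vs where "vs = (SOME vs. ordered_basis scale vs)"
  have vs: "ordered_basis scale vs"
    unfolding vs_def using assms(1) by (rule someI)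
  have "end_trace scale (\<lambda>v. scale (\<phi> v) w) = (\<Sum>i<length vs. coord scale vs i (scale (\<phi> (vs ! i)) w))"
    by (simp add: end_trace_def vs_def[symmetric] matrix_wrt_def coord_def Let_def)
  also have "\<dots> = \<phi> (\<Sum>i<length vs. scale (coord scale vs i w) (vs ! i))"
    by (simp add: coord_simps[OF vs] phi.sum phi.scale mult.commute)
  also have "\<dots> = \<phi> w"
    by (simp add: sum_coord[OF vs])
  finally show ?thesis .
qed

text \<open>An idempotent fixes its range, which contains \<open>vs ! i\<close>; every other
  \<open>vs ! j\<close> has a different eigenvalue by injectivity and so lies in the kernel. These
  values on the basis determine \<open>P\<close>.\<close>

lemma primitive_idempotent_eigenbasis:
  assumes vs: "ordered_basis scale vs"
    and eig: "\<And>j. j < length vs \<Longrightarrow> f (vs ! j) = scale (\<theta> j) (vs ! j)"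
    and inj: "inj_on \<theta> {..<length vs}"
    and i: "i < length vs" and P: "primitive_idempotent scale f (\<theta> i) P"
  shows "P v = scale (coord scale vs i v) (vs ! i)"
proof (rule linear_eq_coord_scale[OF vs _ i])
  have P': "Vector_Spaces.linear scale scale P" "P \<circ> P = P" "range P = eigenspace scale f (\<theta> i)"
    "{v. P v = 0} = span (\<Union>\<mu>\<in>eigenvalues scale f - {\<theta> i}. eigenspace scale f \<mu>)"
    using P by (auto simp: primitive_idempotent_def projection_along_def)
  then show "Vector_Spaces.linear scale scale P" by simp
  fix j assume j: "j < length vs"
  show "P (vs ! j) = (if j = i then vs ! i else 0)"
  proof (cases "j = i")
    case True
    have "vs ! i \<in> range P"
      using i eig by (simp add: P' eigenspace_def)
    then show ?thesis
      using P'(2) True by (auto simp: fun_eq_iff)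
  next
    case False
    then have "\<theta> j \<noteq> \<theta> i"
      using inj i j by (auto simp: inj_on_def)
    moreover have "vs ! j \<noteq> 0"
      using vs dependent_zero[of "set vs"] nth_mem[OF j] by (auto simp: ordered_basis_def)
    then have "\<theta> j \<in> eigenvalues scale f"
      using eig[OF j] by (auto simp: eigenvalues_def)
    ultimately have "vs ! j \<in> {v. P v = 0}"
      unfolding P'(4) using eig[OF j] by (intro span_base) (auto simp: eigenspace_def)
    with False show ?thesis by simp
  qed
qed

text \<open>Generators are peeled off one at a time, so they may coincide; uniqueness of the
  coefficients is a separate matter.\<close>

lemma span_functions:
  "Modules.module.span (\<lambda>c f v. scale c (f v)) {f, g, h, k} =
     {X :: 'b \<Rightarrow> 'b. \<exists>x y z w. X = (\<lambda>v. scale x (f v) + scale y (g v) + scale z (h v) + scale w (k v))}"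
proof -
  interpret F: module "\<lambda>c (f :: 'b \<Rightarrow> 'b) v. scale c (f v)"
    by unfold_locales (auto simp: fun_eq_iff scale_right_distrib scale_left_distrib)
  have *: "X \<in> F.span {f, g, h, k} \<longleftrightarrow>
      (\<exists>x y z w. X = (\<lambda>v. scale x (f v) + scale y (g v) + scale z (h v) + scale w (k v)))" for X
    by (simp add: F.span_breakdown_eq fun_eq_iff diff_eq_eq add_ac)
  then show ?thesis
    by blast
qed

end

theorem proposition6p8:
  fixes scale :: "'a::alg_closed_field \<Rightarrow> 'b::ab_group_add \<Rightarrow> 'b"
    and d :: nat
    and A As :: "'b \<Rightarrow> 'b"
    and E Es :: "nat \<Rightarrow> 'b \<Rightarrow> 'b"
    and \<theta>s a am ap :: "nat \<Rightarrow> 'a"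
    and L :: "'a mat"
  assumes "vector_space scale"
    and "vector_space.dim scale (UNIV :: 'b set) = d + 1"
    and "d \<ge> 3"
    and "leonard_system scale d A E As Es"
    and "dual_eigenvalue_sequence scale d As Es \<theta>s"
    and "\<And>i. i \<le> d \<Longrightarrow> a i = end_trace scale (Es i \<circ> A)"
    and "\<And>i. i \<le> d \<Longrightarrow> am i = (a i - a 0) * (\<theta>s i - \<theta>s d)"
    and "\<And>i. i \<le> d \<Longrightarrow> ap i = (a i - a d) * (\<theta>s i - \<theta>s 0)"
    and "L = mat_of_rows (d + 1)
               [vec (d + 1) (\<lambda>_. 1), vec (d + 1) \<theta>s, vec (d + 1) am, vec (d + 1) ap]"
  shows
    "(zero_diagonal_space scale d A As Es \<noteq> {\<lambda>_. 0}
        \<longleftrightarrow> vec_space.rank 4 L \<le> 3) \<and>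
     (vec_space.rank 4 L \<le> 3
        \<longleftrightarrow> linearly_dependent_pair (vec (d + 1) am) (vec (d + 1) ap)) \<and>
     (linearly_dependent_pair (vec (d + 1) am) (vec (d + 1) ap)
        \<longleftrightarrow> (\<forall>i\<le>d. \<forall>j\<le>d. am i * ap j = ap i * am j)) \<and>
     ((\<forall>i\<le>d. \<forall>j\<le>d. am i * ap j = ap i * am j)
        \<longleftrightarrow> linearly_dependent_pair (vec (d - 1) (\<lambda>i. am (i + 1))) (vec (d - 1) (\<lambda>i. ap (i + 1)))) \<and>
     (linearly_dependent_pair (vec (d - 1) (\<lambda>i. am (i + 1))) (vec (d - 1) (\<lambda>i. ap (i + 1)))
        \<longleftrightarrow> (\<forall>i\<in>{1..d-1}. \<forall>j\<in>{1..d-1}. am i * ap j = ap i * am j))"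
proof -

  \<comment> \<open>The Leonard system in a standard eigenbasis of \<open>As\<close>\<close>
  interpret vector_space scale by fact
  let ?LD = linearly_dependent_pair
  obtain \<theta> vs where \<theta>: "bij_betw \<theta> {..d} (eigenvalues scale As)"
    and idem: "\<And>i. i \<le> d \<Longrightarrow> primitive_idempotent scale As (\<theta> i) (Es i)"
    and len: "length vs = d + 1"
    and eig: "\<And>i. i \<le> d \<Longrightarrow> As (vs ! i) = scale (\<theta> i) (vs ! i)"
    and vs: "ordered_basis scale vs"
    and tri: "irreducible_tridiagonal_mat (matrix_wrt scale vs A)"
    using assms(4) unfolding leonard_system_def standard_ordering_def leonard_basis_def by blast
  interpret A: Vector_Spaces.linear scale scale A
    using assms(4) by (simp add: leonard_system_def leonard_pair_def)
  interpret As: Vector_Spaces.linear scale scale As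
    using assms(4) by (simp add: leonard_system_def leonard_pair_def)
  note coord = coord_simps[OF vs]
  have coord_vs: "coord scale vs i (vs ! j) = (if i = j then 1 else 0)" if "i \<le> d" "j \<le> d" for i j
    using that by (simp add: coord_nth[OF vs] len)
  have vs_nz: "vs ! i \<noteq> 0" if "i \<le> d" for i
    using coord_vs[OF that that] coord(3) by auto
  have Es: "Es i v = scale (coord scale vs i v) (vs ! i)" if "i \<le> d" for i v
    by (rule primitive_idempotent_eigenbasis[OF vs, of As \<theta>])
      (use that \<theta> eig idem in \<open>auto simp: len bij_betw_def lessThan_Suc_atMost\<close>)
  \<comment> \<open>\<open>Es i\<close> fixes \<open>vs ! i\<close>, so evaluating
    \<open>As \<circ> Es i\<close> there compares the two eigenvalues.\<close>
  have \<theta>s_\<theta>: "\<theta>s i = \<theta> i" if "i \<le> d" for i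
  proof -
    have "Es i (vs ! i) = vs ! i"
      using that by (simp add: Es coord_vs)
    then have "scale (\<theta> i) (vs ! i) = scale (\<theta>s i) (vs ! i)"
      using assms(5) that eig[OF that] unfolding dual_eigenvalue_sequence_def fun_eq_iff comp_def by metis
    then show ?thesis
      using vs_nz[OF that] by simp
  qed
  have \<theta>s_inj: "\<theta>s i = \<theta>s j \<longleftrightarrow> i = j" if "i \<le> d" "j \<le> d" for i j
    using \<theta> that by (auto simp: \<theta>s_\<theta> bij_betw_def inj_on_def)
  \<comment> \<open>A polynomial of degree at most one with two distinct roots is zero. Every
    elimination below rests on this.\<close>
  have affine: "x = 0 \<and> y = 0"
    if "x + y * \<theta>s i = 0" "x + y * \<theta>s j = 0" "i \<le> d" "j \<le> d" "i \<noteq> j" for x y i j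
  proof -
    have "y * (\<theta>s i - \<theta>s j) = (x + y * \<theta>s i) - (x + y * \<theta>s j)"
      by (simp add: algebra_simps)
    then have "y = 0"
      using that \<theta>s_inj[of i j] by simp
    then show ?thesis
      using that(1) by simp
  qed
  \<comment> \<open>\<open>Es i \<circ> A\<close> has rank one: it sends \<open>v\<close> to
    \<open>vs ! i\<close> scaled by the \<open>i\<close>-th coordinate of
    \<open>A v\<close>.\<close>
  have a: "coord scale vs i (A (vs ! i)) = a i" if "i \<le> d" for i
  proof -
    have "Vector_Spaces.linear scale (*) (coord scale vs i \<circ> A)"
      using A.linear_axioms linear_coord[OF vs] by (rule Vector_Spaces.linear_compose)
    then have "end_trace scale (\<lambda>v. scale ((coord scale vs i \<circ> A) v) (vs ! i))
        = (coord scale vs i \<circ> A) (vs ! i)"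
      by (rule end_trace_rank_one[OF vs])
    then show ?thesis
      using that by (simp add: assms(6) Es comp_def)
  qed

  \<comment> \<open>The zero diagonal space in coordinates\<close>
  define comb where "comb x y z w = (\<lambda>v. scale x (id v) + scale y (As v) + scale z (A v) + scale w ((A \<circ> As) v))"
    for x y z w
  define zero_diag where "zero_diag x y z w \<longleftrightarrow> (\<forall>i\<le>d. x + y * \<theta>s i + z * a i + w * (a i * \<theta>s i) = 0)"
    for x y z w
  have comb_scale: "comb x y z w (scale c v) = scale c (comb x y z w v)" for x y z w c v
    by (simp add: comb_def A.scale As.scale scale_right_distrib mult.commute)
  \<comment> \<open>In \<open>A \<circ> As\<close> the map \<open>As\<close> acts first, as the
    scalar \<open>\<theta>s j\<close> on \<open>vs ! j\<close>; column \<open>j\<close> is therefore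
    a combination of column \<open>j\<close> of the identity and column \<open>j\<close> of
    \<open>A\<close>.\<close>
  have comb_coord: "coord scale vs i (comb x y z w (vs ! j)) =
      (x + y * \<theta>s j) * coord scale vs i (vs ! j) + (z + w * \<theta>s j) * coord scale vs i (A (vs ! j))"
    if "j \<le> d" for i j x y z w
    using that by (simp add: comb_def coord eig A.scale \<theta>s_\<theta> algebra_simps)
  have Z: "X \<in> zero_diagonal_space scale d A As Es \<longleftrightarrow>
      (\<exists>x y z w. X = comb x y z w \<and> zero_diag x y z w)" for X
  proof -
    \<comment> \<open>The sandwiched map is \<open>Es i\<close> times the \<open>i\<close>-th
      diagonal entry, and evaluation at \<open>vs ! i\<close> recovers that entry.\<close>
    have "Es i \<circ> comb x y z w \<circ> Es i = (\<lambda>_. 0) \<longleftrightarrow> x + y * \<theta>s i + z * a i + w * (a i * \<theta>s i) = 0"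
      if i: "i \<le> d" for x y z w i
    proof -
      have "(Es i \<circ> comb x y z w \<circ> Es i) v =
          scale (coord scale vs i v * (x + y * \<theta>s i + z * a i + w * (a i * \<theta>s i))) (vs ! i)" for v
        using i by (simp add: Es comb_scale coord comb_coord coord_vs a algebra_simps)
      then show ?thesis
        using vs_nz[OF i] coord_vs[OF i i] by (auto simp: fun_eq_iff dest: spec[of _ "vs ! i"])
    qed
    then show ?thesis
      unfolding zero_diagonal_space_def span_functions comb_def[symmetric] zero_diag_def mem_Collect_eq
      by metis
  qed
  \<comment> \<open>The superdiagonal entries of \<open>A\<close> are nonzero, so those in columns 1
    and 2 force \<open>z + w * \<theta>s j\<close> to vanish for two values of \<open>j\<close>.
    Once \<open>z\<close> and \<open>w\<close> are gone, the diagonal gives \<open>x\<close> and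
    \<open>y\<close> in the same way. This independence lets nonzero elements be traded for nonzero
    coefficient tuples.\<close>
  have comb_0: "x = 0 \<and> y = 0 \<and> z = 0 \<and> w = 0" if X: "comb x y z w = (\<lambda>_. 0)" for x y z w
  proof -
    have super: "coord scale vs i (A (vs ! (i + 1))) \<noteq> 0" if "i + 1 \<le> d" for i
    proof -
      have "matrix_wrt scale vs A $$ (i, i + 1) \<noteq> 0"
        using tri[unfolded irreducible_tridiagonal_mat_def, rule_format, of i "i + 1"] that
        by (simp add: matrix_wrt_def len)
      then show ?thesis
        using that by (simp add: matrix_wrt_def len coord_def)
    qed
    have "z + w * \<theta>s (i + 1) = 0" if "i + 1 \<le> d" for i
      using comb_coord[of "i + 1" i x y z w] super[OF that] that X
      by (simp add: coord coord_vs)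
    from this[of 0] this[of 1] have "z + w * \<theta>s 1 = 0" "z + w * \<theta>s 2 = 0"
      using assms(3) by (auto simp: numeral_2_eq_2)
    then have zw: "z = 0" "w = 0"
      using affine[of z w 1 2] assms(3) by auto
    have "x + y * \<theta>s i = 0" if "i \<le> d" for i
      using comb_coord[of i i x y z w] that X zw
      by (simp add: coord coord_vs)
    from this[of 0] this[of 1] show ?thesis
      using affine[of x y 0 1] assms(3) zw by auto
  qed
  have ends: "am 0 = 0" "am d = 0" "ap 0 = 0" "ap d = 0"
    by (simp_all add: assms(7,8))

  \<comment> \<open>Zero diagonal elements versus dependence of \<open>am\<close> and
    \<open>ap\<close>\<close>
  have LD: "?LD (vec (d + 1) am) (vec (d + 1) ap) \<longleftrightarrow>
      (\<exists>l m. (l \<noteq> 0 \<or> m \<noteq> 0) \<and> (\<forall>i\<le>d. l * am i + m * ap i = 0))"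
    by (simp add: linearly_dependent_pair_vec_iff less_Suc_eq_le)

  have "zero_diagonal_space scale d A As Es \<noteq> {\<lambda>_. 0} \<longleftrightarrow>
      (\<exists>x y z w. (x \<noteq> 0 \<or> y \<noteq> 0 \<or> z \<noteq> 0 \<or> w \<noteq> 0) \<and> zero_diag x y z w)"
  proof -
    have comb_nz: "comb x y z w \<noteq> (\<lambda>_. 0) \<longleftrightarrow> (x \<noteq> 0 \<or> y \<noteq> 0 \<or> z \<noteq> 0 \<or> w \<noteq> 0)" for x y z w
      using comb_0[of x y z w] by (auto simp: comb_def)
    have "comb 0 0 0 0 = (\<lambda>_. 0)" "zero_diag 0 0 0 0"
      by (simp_all add: comb_def zero_diag_def)
    then have "(\<lambda>_. 0) \<in> zero_diagonal_space scale d A As Es"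
      unfolding Z by metis
    then have "zero_diagonal_space scale d A As Es \<noteq> {\<lambda>_. 0} \<longleftrightarrow>
        (\<exists>X \<in> zero_diagonal_space scale d A As Es. X \<noteq> (\<lambda>_. 0))"
      by blast
    also have "\<dots> \<longleftrightarrow> (\<exists>x y z w. comb x y z w \<noteq> (\<lambda>_. 0) \<and> zero_diag x y z w)"
      unfolding Bex_def Z by metis
    also have "\<dots> \<longleftrightarrow> (\<exists>x y z w. (x \<noteq> 0 \<or> y \<noteq> 0 \<or> z \<noteq> 0 \<or> w \<noteq> 0) \<and> zero_diag x y z w)"
      by (simp only: comb_nz)
    finally show ?thesis .
  qed
  also have "\<dots> \<longleftrightarrow> ?LD (vec (d + 1) am) (vec (d + 1) ap)"
  proof -
    have expand: "l * am i + m * ap i = (l * a 0 * \<theta>s d + m * a d * \<theta>s 0) + (- l * a 0 - m * a d) * \<theta>s i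
        + (- l * \<theta>s d - m * \<theta>s 0) * a i + (l + m) * (a i * \<theta>s i)" if "i \<le> d" for l m i
      using that by (simp add: assms(7,8) algebra_simps)
    show ?thesis
      unfolding LD
    proof
      assume "\<exists>x y z w. (x \<noteq> 0 \<or> y \<noteq> 0 \<or> z \<noteq> 0 \<or> w \<noteq> 0) \<and> zero_diag x y z w"
      then obtain x y z w where nz0: "x \<noteq> 0 \<or> y \<noteq> 0 \<or> z \<noteq> 0 \<or> w \<noteq> 0" and zero: "zero_diag x y z w"
        by blast
      show "\<exists>l m. (l \<noteq> 0 \<or> m \<noteq> 0) \<and> (\<forall>i\<le>d. l * am i + m * ap i = 0)"
      proof (rule ccontr)
        assume nz: "\<not> (\<exists>l m. (l \<noteq> 0 \<or> m \<noteq> 0) \<and> (\<forall>i\<le>d. l * am i + m * ap i = 0))"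
        define D where "D = \<theta>s 0 - \<theta>s d"
        have D: "D \<noteq> 0"
          using \<theta>s_inj[of 0 d] assms(3) by (simp add: D_def)
        \<comment> \<open>\<open>l\<close> and \<open>m\<close> solve the 2 by 2 system recorded in
          \<open>lm\<close>: they make the coefficients of \<open>a\<close> and
          \<open>a * \<theta>s\<close> in \<open>expand\<close> equal to \<open>z\<close> and
          \<open>w\<close>.\<close>
        define l where "l = (z + w * \<theta>s 0) / D"
        define m where "m = - (z + w * \<theta>s d) / D"
        have lD: "l * D = z + w * \<theta>s 0" and mD: "m * D = - (z + w * \<theta>s d)"
          using D by (simp_all add: l_def m_def)
        have "(l + m) * D = w * D"
          unfolding distrib_right lD mD by (simp add: D_def algebra_simps)
        moreover have "(- l * \<theta>s d - m * \<theta>s 0) * D = - \<theta>s d * (l * D) - \<theta>s 0 * (m * D)"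
          by (simp add: algebra_simps)
        then have "(- l * \<theta>s d - m * \<theta>s 0) * D = z * D"
          unfolding lD mD by (simp add: D_def algebra_simps)
        ultimately have lm: "l + m = w" "- l * \<theta>s d - m * \<theta>s 0 = z"
          using D by simp_all
        \<comment> \<open>Subtracting the given relation from \<open>expand\<close> leaves only an
          affine remainder \<open>p + q * \<theta>s i\<close>; it vanishes at 0 and \<open>d\<close>
          because \<open>am\<close> and \<open>ap\<close> do.\<close>
        define p where "p = (l * a 0 * \<theta>s d + m * a d * \<theta>s 0) - x"
        define q where "q = (- l * a 0 - m * a d) - y"
        have rel: "l * am i + m * ap i = p + q * \<theta>s i" if "i \<le> d" for i
        proof -
          have "x + y * \<theta>s i + z * a i + w * (a i * \<theta>s i) = 0"
            using zero that by (simp add: zero_diag_def)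
          then show ?thesis
            unfolding expand[OF that] lm p_def q_def by (simp add: algebra_simps)
        qed
        have pq: "p = 0" "q = 0"
          using affine[of p q 0 d] rel[of 0] rel[of d] ends assms(3) by simp_all
        then have "\<forall>i\<le>d. l * am i + m * ap i = 0"
          using rel by simp
        then have "l = 0 \<and> m = 0"
          using nz by blast
        \<comment> \<open>With \<open>l\<close> and \<open>m\<close> zero, \<open>lm\<close> gives
          \<open>z\<close> and \<open>w\<close> zero, and then \<open>p\<close> and \<open>q\<close>
          being zero gives \<open>x\<close> and \<open>y\<close> zero.\<close>
        then show False
          using lm pq nz0 by (auto simp: p_def q_def)
      qed
    next
      assume "\<exists>l m. (l \<noteq> 0 \<or> m \<noteq> 0) \<and> (\<forall>i\<le>d. l * am i + m * ap i = 0)"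
      then obtain l m where lm: "l \<noteq> 0 \<or> m \<noteq> 0" "\<And>i. i \<le> d \<Longrightarrow> l * am i + m * ap i = 0"
        by blast
      have "zero_diag (l * a 0 * \<theta>s d + m * a d * \<theta>s 0) (- l * a 0 - m * a d) (- l * \<theta>s d - m * \<theta>s 0) (l + m)"
        unfolding zero_diag_def using lm(2) expand by auto
      \<comment> \<open>The last two coefficients already determine \<open>l\<close> and
        \<open>m\<close>, since \<open>\<theta>s 0\<close> and \<open>\<theta>s d\<close>
        differ.\<close>
      moreover have "- l * \<theta>s d - m * \<theta>s 0 \<noteq> 0 \<or> l + m \<noteq> 0"
      proof (rule ccontr)
        assume "\<not> ?thesis"
        then have "m = - l" "l * (\<theta>s 0 - \<theta>s d) = 0"
          by (auto simp: algebra_simps add_eq_0_iff)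
        then show False
          using lm(1) \<theta>s_inj[of 0 d] assms(3) by auto
      qed
      ultimately show "\<exists>x y z w. (x \<noteq> 0 \<or> y \<noteq> 0 \<or> z \<noteq> 0 \<or> w \<noteq> 0) \<and> zero_diag x y z w"
        by blast
    qed
  qed
  finally have i_iii: "zero_diagonal_space scale d A As Es \<noteq> {\<lambda>_. 0} \<longleftrightarrow>
      ?LD (vec (d + 1) am) (vec (d + 1) ap)" .

  \<comment> \<open>The rank of \<open>L\<close>\<close>
  have ii_iii: "vec_space.rank 4 L \<le> 3 \<longleftrightarrow> ?LD (vec (d + 1) am) (vec (d + 1) ap)"
  proof -
    have L: "L \<in> carrier_mat 4 (d + 1)"
      unfolding assms(9) by (rule carrier_matI) simp_all
    \<comment> \<open>The product with column \<open>j\<close> is the \<open>j\<close>-th entry of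
      the combination of rows with coefficients \<open>y\<close>, so left null vectors are relations
      among the rows.\<close>
    have colL: "y \<bullet> col L j = y $ 0 + y $ 1 * \<theta>s j + y $ 2 * am j + y $ 3 * ap j"
      if "j \<le> d" for y :: "'a vec" and j
    proof -
      have "col L j = vec_of_list [1, \<theta>s j, am j, ap j]"
        using that unfolding assms(9)
        by (intro eq_vecI) (auto simp: col_def mat_of_rows_def elim!: less_SucE)
      then show ?thesis
        by (simp add: scalar_prod_def eval_nat_numeral)
    qed
    have setL: "set (cols L) = col L ` {..d}"
      using L by (simp only: cols_def carrier_matD set_map set_upt atLeast0LessThan
        lessThan_Suc_atMost Suc_eq_plus1[symmetric])
    have null: "(\<forall>c\<in>set (cols L). y \<bullet> c = 0) \<longleftrightarrow>
        (\<forall>j\<le>d. y $ 0 + y $ 1 * \<theta>s j + y $ 2 * am j + y $ 3 * ap j = 0)" for y :: "'a vec"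
      unfolding setL using colL by auto
    have "vec_space.rank 4 L \<le> 3 \<longleftrightarrow> vec_space.rank 4 L < 4"
      by auto
    also have "\<dots> \<longleftrightarrow> (\<exists>y\<in>carrier_vec 4. y \<noteq> 0\<^sub>v 4 \<and> (\<forall>c\<in>set (cols L). y \<bullet> c = 0))"
      by (rule vec_space.rank_less_iff_left_null_vector[OF L])
    also have "\<dots> \<longleftrightarrow> (\<exists>y\<in>carrier_vec 4. y \<noteq> 0\<^sub>v 4 \<and>
        (\<forall>j\<le>d. y $ 0 + y $ 1 * \<theta>s j + y $ 2 * am j + y $ 3 * ap j = 0))"
      by (simp only: null)
    also have "\<dots> \<longleftrightarrow> ?LD (vec (d + 1) am) (vec (d + 1) ap)"
      unfolding LD
    proof
      assume "\<exists>y\<in>carrier_vec 4. y \<noteq> 0\<^sub>v 4 \<and>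
        (\<forall>j\<le>d. y $ 0 + y $ 1 * \<theta>s j + y $ 2 * am j + y $ 3 * ap j = 0)"
      then obtain y where y: "y \<in> carrier_vec 4" "y \<noteq> 0\<^sub>v 4"
        and rel: "\<And>j. j \<le> d \<Longrightarrow> y $ 0 + y $ 1 * \<theta>s j + y $ 2 * am j + y $ 3 * ap j = 0"
        by blast
      \<comment> \<open>At 0 and \<open>d\<close> only the first two terms of \<open>rel\<close>
        survive.\<close>
      have y01: "y $ 0 = 0 \<and> y $ 1 = 0"
        using affine[of "y $ 0" "y $ 1" 0 d] rel[of 0] rel[of d] ends assms(3) by simp
      have "y $ 2 \<noteq> 0 \<or> y $ 3 \<noteq> 0"
      proof (rule ccontr)
        assume "\<not> ?thesis"
        then have "y $ i = 0" if "i < 4" for i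
          using that y01 by (auto simp: eval_nat_numeral less_Suc_eq)
        then show False
          using y by (auto simp: vec_eq_iff)
      qed
      then show "\<exists>l m. (l \<noteq> 0 \<or> m \<noteq> 0) \<and> (\<forall>i\<le>d. l * am i + m * ap i = 0)"
        using rel y01 by (intro exI[of _ "y $ 2"] exI[of _ "y $ 3"]) auto
    next
      assume "\<exists>l m. (l \<noteq> 0 \<or> m \<noteq> 0) \<and> (\<forall>i\<le>d. l * am i + m * ap i = 0)"
      then obtain l m where lm: "l \<noteq> 0 \<or> m \<noteq> 0" "\<And>i. i \<le> d \<Longrightarrow> l * am i + m * ap i = 0"
        by blast
      define y where "y = vec 4 (\<lambda>i. if i = 2 then l else if i = 3 then m else 0)"
      have "y \<in> carrier_vec 4" "y $ 0 = 0" "y $ 1 = 0" "y $ 2 = l" "y $ 3 = m"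
        by (simp_all add: y_def)
      moreover from this have "y \<noteq> 0\<^sub>v 4"
        using lm(1) by auto
      ultimately show "\<exists>y\<in>carrier_vec 4. y \<noteq> 0\<^sub>v 4 \<and>
          (\<forall>j\<le>d. y $ 0 + y $ 1 * \<theta>s j + y $ 2 * am j + y $ 3 * ap j = 0)"
        using lm(2) by (intro bexI[of _ y]) auto
    qed
    finally show ?thesis .
  qed

  \<comment> \<open>Minors and restriction to the interior indices\<close>
  have iii_iv: "?LD (vec (d + 1) am) (vec (d + 1) ap) \<longleftrightarrow> (\<forall>i\<le>d. \<forall>j\<le>d. am i * ap j = ap i * am j)"
    by (simp add: linearly_dependent_pair_vec_iff_minors less_Suc_eq_le)
  have v_vi: "?LD (vec (d - 1) (\<lambda>i. am (i + 1))) (vec (d - 1) (\<lambda>i. ap (i + 1))) \<longleftrightarrow>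
      (\<forall>i\<in>{1..d-1}. \<forall>j\<in>{1..d-1}. am i * ap j = ap i * am j)"
  proof -
    \<comment> \<open>The truncated vectors are indexed from 0, with entry \<open>i\<close> taken at
      \<open>i + 1\<close>.\<close>
    have "{1..d - 1} = Suc ` {..<d - 1}"
      by (simp add: image_Suc_lessThan)
    then show ?thesis
      by (simp add: linearly_dependent_pair_vec_iff_minors Ball_def[of "{..<_}"])
  qed
  have iv_vi: "(\<forall>i\<le>d. \<forall>j\<le>d. am i * ap j = ap i * am j) \<longleftrightarrow>
      (\<forall>i\<in>{1..d-1}. \<forall>j\<in>{1..d-1}. am i * ap j = ap i * am j)" (is "?l \<longleftrightarrow> ?r")
  proof
    assume r: ?r
    show ?l
    proof (intro allI impI)
      fix i j assume "i \<le> d" "j \<le> d"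
      \<comment> \<open>If either index is an endpoint, both products contain a vanishing factor;
        otherwise the minor is an interior one.\<close>
      then have "i \<in> {0, d} \<or> j \<in> {0, d} \<or> i \<in> {1..d - 1} \<and> j \<in> {1..d - 1}"
        by auto
      then show "am i * ap j = ap i * am j"
        using ends r by auto
    qed
  qed auto
  show ?thesis
    using i_iii ii_iii iii_iv v_vi iv_vi by blast
qed

end
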